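(* Let $\mathcal{H}$ be a real Hilbert space, let $K$ be a nonempty closed convex cone in $\mathcal{H}$, let $\rho>0$, and set $C:=K\cap S(0;\rho)$. Suppose that $K\neq\{0\}$. Then the following hold: (i) For every $x\in K^{\perp}$, $P_Cx=C$ and $d_C(x)=\sqrt{\|x\|^2+\rho^2}$. (ii) For every $x\in\mathcal{H}\smallsetminus K^{\ominus}$, $$P_Cx=\left\{\frac{\rho}{\|P_Kx\|}P_Kx\right\}\quad\text{and}\quad d_C(x)=\sqrt{d_K^2(x)+(\|P_Kx\|-\rho)^2}.$$
   Context: A subset $K$ of $\mathcal{H}$ is a cone if $K=\bigcup_{\lambda>0}\lambda K$. $S(0;\rho)=\{y\in\mathcal{H}:\|y\|=\rho\}$. $K^{\perp}=\{u\in\mathcal{H}: \langle u,y\rangle=0\ \text{for all } y\in K\}$ and $K^{\ominus}=\{u\in\mathcal{H}:\sup_{y\in K}\langle u,y\rangle\le 0\}$ (polar cone). For a nonempty subset $C$ of $\mathcal{H}$, $d_C(x)=\inf_{y\in C}\|x-y\|$ and the (set-valued, possibly empty-valued) projector is $P_Cx=\{u\in C:\|x-u\|=d_C(x)\}$. When the set is nonempty, closed and convex (as for $K$), $P_Kx$ is a singleton and is identified with its unique element. *)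

theory Defs
  imports "HOL-Analysis.Analysis"
begin

text \<open>
  The library predicate \<open>cone\<close> also requires closure under multiplication by \<open>0\<close>; here
  only strictly positive multiples are taken.
\<close>
definition is_cone :: "'a::real_vector set \<Rightarrow> bool"
  where "is_cone K \<longleftrightarrow> K = (\<Union>l\<in>{0<..}. (\<lambda>y. l *\<^sub>R y) ` K)"

text \<open>
  The supremum is taken in the extended reals because it may be infinite; on an unbounded
  set the real-valued \<open>Sup\<close> is unspecified.
\<close>
definition polar_cone :: "'a::real_inner set \<Rightarrow> 'a set"
  where "polar_cone K = {u. (SUP y\<in>K. ereal (u \<bullet> y)) \<le> 0}"

text \<open>
  The set-valued projector.  The library's \<open>closest_point\<close> is a single choice of such a point
  and is restricted to Heine--Borel (hence finite-dimensional) spaces.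
\<close>
definition projector :: "'a::real_normed_vector set \<Rightarrow> 'a \<Rightarrow> 'a set"
  where "projector C x = {u \<in> C. norm (x - u) = infdist x C}"

text \<open>
  The point identified with the projector when the latter is a singleton, as it is for a
  nonempty closed convex subset of a Hilbert space; unspecified otherwise.
\<close>
definition proj_point :: "'a::real_normed_vector set \<Rightarrow> 'a \<Rightarrow> 'a"
  where "proj_point C x = the_elem (projector C x)"

end

theory Submission
  imports Defs
begin

text \<open>
  Let \<open>p\<close> be the projection of \<open>x\<close> onto \<open>K\<close>. Moreau's characterization says that \<open>p \<in> K\<close>,
  that \<open>x - p\<close> is orthogonal to \<open>p\<close> and that \<open>(x - p) \<bullet> y \<le> 0\<close> for all \<open>y \<in> K\<close>. Expanding the
  square around \<open>p\<close>, and comparing \<open>p \<bullet> y\<close> with \<open>norm p * \<rho>\<close>, every \<open>y\<close> of norm \<open>\<rho>\<close> satisfies,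
  with \<open>z = (\<rho> / norm p) p\<close>,
  \[ \|x-y\|^2 = \|x-p\|^2 + (\|p\|-\rho)^2 - 2\langle x-p, y\rangle + (\|p\|/\rho)\,\|z-y\|^2 . \]
  On \<open>K\<close> the last two terms are nonnegative, and they vanish at \<open>y = z\<close>, which lies in the cone;
  since the last term is positive for \<open>y \<noteq> z\<close>, this gives the distance and the uniqueness of the
  minimizer at once. What makes \<open>z\<close> meaningful is \<open>p \<noteq> 0\<close>: if \<open>p = 0\<close>, the
  characterization would put \<open>x\<close> into the polar cone.

  If instead \<open>x\<close> is orthogonal to \<open>K\<close>, Pythagoras shows that \<open>x\<close> has the same distance from every
  point of the nonempty set \<open>C\<close>.

  The existence of \<open>p\<close> is the Hilbert space projection theorem: by the parallelogram law, points
  of a convex set that are almost nearest to \<open>x\<close> are close to each other, and completeness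
  provides a nearest one.
\<close>

section \<open>Nearest points in a Hilbert space\<close>

lemma infdist_eq_if_nearest:
  fixes C :: "'a::real_normed_vector set"
  assumes "u \<in> C" and "\<And>y. y \<in> C \<Longrightarrow> norm (x - u) \<le> norm (x - y)"
  shows "infdist x C = norm (x - u)"
proof (rule antisym)
  show "infdist x C \<le> norm (x - u)"
    using infdist_le[OF assms(1)] by (simp add: dist_norm)
  have "norm (x - u) \<le> (INF y\<in>C. dist x y)"
    using assms by (intro cINF_greatest) (auto simp: dist_norm)
  then show "norm (x - u) \<le> infdist x C"
    using assms(1) by (auto simp: infdist_def)
qed

text \<open>
  This is the parallelogram law for \<open>x - u\<close> and \<open>x - v\<close>: half their sum is the difference of \<open>x\<close>
  and the midpoint of \<open>u\<close> and \<open>v\<close>, which lies in the convex set and so is no closer to \<open>x\<close> than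
  the infimal distance.
\<close>
lemma convex_almost_nearest_close:
  fixes K :: "'a::real_inner set"
  assumes "convex K" "u \<in> K" "v \<in> K"
  shows "(norm (u - v))\<^sup>2 \<le> 2 * (norm (x - u))\<^sup>2 + 2 * (norm (x - v))\<^sup>2 - 4 * (infdist x K)\<^sup>2"
proof -
  define m where "m = (1/2) *\<^sub>R u + (1/2) *\<^sub>R v"
  have "m \<in> K"
    unfolding m_def using assms by (intro convexD) auto
  then have "infdist x K \<le> norm (x - m)"
    using infdist_le[of m K x] by (simp add: dist_norm)
  then have "(infdist x K)\<^sup>2 \<le> (norm (x - m))\<^sup>2"
    by (simp add: infdist_nonneg power_mono)
  moreover have "(norm (u - v))\<^sup>2 = 2 * (norm (x - u))\<^sup>2 + 2 * (norm (x - v))\<^sup>2 - 4 * (norm (x - m))\<^sup>2"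
    unfolding m_def power2_norm_eq_inner
    by (simp add: inner_diff_left inner_diff_right inner_add_left inner_add_right inner_commute
        algebra_simps)
  ultimately show ?thesis by linarith
qed

text \<open>
  The points of \<open>K\<close> within distance \<open>infdist x K + 1 / (n + 1)\<close> of \<open>x\<close> form a decreasing sequence
  of nonempty closed sets whose diameters tend to zero; their common point is nearest to \<open>x\<close>.
\<close>
theorem Hilbert_projection:
  fixes K :: "'a::{real_inner, complete_space} set"
  assumes "K \<noteq> {}" "closed K" "convex K"
  obtains p where "projector K x = {p}"
proof -
  define d where "d = infdist x K"
  define S where "S n = K \<inter> cball x (d + inverse (real (Suc n)))" for n
  have mem: "y \<in> S n \<longleftrightarrow> y \<in> K \<and> norm (x - y) \<le> d + inverse (real (Suc n))" for y n
    by (simp add: S_def dist_norm)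
  have S_closed: "closed (S n)" for n
    unfolding S_def using assms by (intro closed_Int) auto
  have S_nonempty: "S n \<noteq> {}" for n
  proof -
    have "(INF y\<in>K. dist x y) < d + inverse (real (Suc n))"
      using assms(1) by (simp add: d_def infdist_def)
    then obtain y where "y \<in> K" "dist x y < d + inverse (real (Suc n))"
      using assms(1) by (subst (asm) cINF_less_iff) (auto intro: bdd_belowI[of _ 0])
    then show ?thesis
      by (auto simp: S_def)
  qed
  have S_decreasing: "S n \<subseteq> S m" if "m \<le> n" for m n
  proof -
    have "inverse (real (Suc n)) \<le> inverse (real (Suc m))"
      using that by (intro le_imp_inverse_le) auto
    then show ?thesis by (force simp only: mem)
  qed
  have S_small: "\<exists>n. \<forall>u\<in>S n. \<forall>v\<in>S n. dist u v < e" if "e > 0" for e :: real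
  proof -
    have "(\<lambda>n. 4 * (d + inverse (real (Suc n)))\<^sup>2 - 4 * d\<^sup>2) \<longlonglongrightarrow> 4 * (d + 0)\<^sup>2 - 4 * d\<^sup>2"
      by (intro tendsto_intros LIMSEQ_inverse_real_of_nat)
    then have "\<forall>\<^sub>F n in sequentially. 4 * (d + inverse (real (Suc n)))\<^sup>2 - 4 * d\<^sup>2 < e\<^sup>2"
      using that by (intro order_tendstoD(2)) auto
    then obtain n where n: "4 * (d + inverse (real (Suc n)))\<^sup>2 - 4 * d\<^sup>2 < e\<^sup>2"
      by (auto simp: eventually_sequentially)
    have "dist u v < e" if u: "u \<in> S n" and v: "v \<in> S n" for u v
    proof -
      have "(norm (x - u))\<^sup>2 \<le> (d + inverse (real (Suc n)))\<^sup>2"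
           "(norm (x - v))\<^sup>2 \<le> (d + inverse (real (Suc n)))\<^sup>2"
        using u v unfolding mem by (blast intro: power_mono norm_ge_zero)+
      moreover have "(norm (u - v))\<^sup>2 \<le> 2 * (norm (x - u))\<^sup>2 + 2 * (norm (x - v))\<^sup>2 - 4 * d\<^sup>2"
        unfolding d_def using u v assms by (intro convex_almost_nearest_close) (auto simp: mem)
      ultimately have "(norm (u - v))\<^sup>2 < e\<^sup>2"
        using n by linarith
      then show ?thesis
        using \<open>e > 0\<close> by (simp add: dist_norm power_less_imp_less_base)
    qed
    then show ?thesis by blast
  qed
  obtain p where p: "\<And>n. p \<in> S n"
    using decreasing_closed_nest[of S, OF S_closed S_nonempty S_decreasing S_small] by blast
  have "p \<in> K"
    using p by (auto simp: mem)
  have "norm (x - p) \<le> d"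
  proof (rule LIMSEQ_le_const)
    show "(\<lambda>n. d + inverse (real (Suc n))) \<longlonglongrightarrow> d"
      using tendsto_add[OF tendsto_const[of d] LIMSEQ_inverse_real_of_nat] by simp
    show "\<exists>N. \<forall>n\<ge>N. norm (x - p) \<le> d + inverse (real (Suc n))"
      using p unfolding mem by blast
  qed
  moreover have "d \<le> norm (x - p)"
    unfolding d_def using infdist_le[OF \<open>p \<in> K\<close>] by (simp add: dist_norm)
  ultimately have dp: "norm (x - p) = d" by simp
  have "u = p" if "u \<in> K" "norm (x - u) = d" for u
  proof -
    have "(norm (u - p))\<^sup>2 \<le> 0"
      using convex_almost_nearest_close[OF assms(3) that(1) \<open>p \<in> K\<close>, of x] dp that(2)
      by (simp add: d_def)
    then show ?thesis by simp
  qed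
  then have "projector K x = {p}"
    using \<open>p \<in> K\<close> dp unfolding projector_def d_def by blast
  then show ?thesis by (rule that)
qed

section \<open>Projection onto a convex cone\<close>

lemma is_cone_scaleR:
  assumes "is_cone K" "y \<in> K" "l > 0"
  shows "l *\<^sub>R y \<in> K"
  using assms unfolding is_cone_def by blast

lemma is_cone_convex_add:
  assumes "is_cone K" "convex K" "y \<in> K" "z \<in> K"
  shows "y + z \<in> K"
proof -
  have "(1/2) *\<^sub>R y + (1/2) *\<^sub>R z \<in> K"
    using assms by (intro convexD) auto
  then have "2 *\<^sub>R ((1/2) *\<^sub>R y + (1/2) *\<^sub>R z) \<in> K"
    using assms(1) by (intro is_cone_scaleR) auto
  then show ?thesis by (simp add: scaleR_add_right)
qed

text \<open>
  The first-order optimality condition: moving from \<open>p\<close> in the direction \<open>h\<close> changes the squared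
  distance by \<open>- 2 t ((x - p) \<bullet> h)\<close> plus a term of order \<open>t\<^sup>2\<close>.
\<close>
lemma inner_nonpos_if_nearest_along:
  fixes x p h :: "'a::real_inner"
  assumes nearest: "\<And>t::real. 0 < t \<Longrightarrow> t < 1 \<Longrightarrow> norm (x - p) \<le> norm (x - (p + t *\<^sub>R h))"
  shows "(x - p) \<bullet> h \<le> 0"
proof -
  have step: "2 * ((x - p) \<bullet> h) \<le> t * (h \<bullet> h)" if "0 < t" "t < 1" for t :: real
  proof -
    have "(norm (x - p))\<^sup>2 \<le> (norm (x - (p + t *\<^sub>R h)))\<^sup>2"
      using nearest[OF that] by (simp add: power_mono)
    also have "\<dots> = (norm (x - p))\<^sup>2 - t * (2 * ((x - p) \<bullet> h)) + t * (t * (h \<bullet> h))"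
      unfolding power2_norm_eq_inner
      by (simp add: inner_diff_left inner_diff_right inner_add_left inner_add_right inner_commute
          algebra_simps)
    finally have "t * (2 * ((x - p) \<bullet> h)) \<le> t * (t * (h \<bullet> h))" by simp
    then show ?thesis using that(1) by simp
  qed
  have "2 * ((x - p) \<bullet> h) \<le> 0"
  proof (rule tendsto_lowerbound)
    show "((\<lambda>t. t * (h \<bullet> h)) \<longlongrightarrow> 0) (at_right 0)"
      by (rule tendsto_eq_intros refl | simp)+
    show "\<forall>\<^sub>F t in at_right 0. 2 * ((x - p) \<bullet> h) \<le> t * (h \<bullet> h)"
      using step by (intro eventually_at_rightI[of 0 1]) auto
  qed simp
  then show ?thesis by simp
qed

text \<open>
  One half of Moreau's characterization of the projection onto a convex cone. The ray from \<open>p\<close> in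
  any direction of \<open>K\<close> stays in \<open>K\<close>, and so does the segment from \<open>p\<close> towards the origin; the
  latter yields the inequality that turns \<open>(x - p) \<bullet> p \<le> 0\<close> into an equality.
\<close>
lemma convex_cone_projection:
  fixes K :: "'a::real_inner set"
  assumes "is_cone K" "convex K" and p: "p \<in> projector K x"
  shows "(x - p) \<bullet> p = 0" and "\<And>y. y \<in> K \<Longrightarrow> (x - p) \<bullet> y \<le> 0"
proof -
  have "p \<in> K"
    using p by (simp add: projector_def)
  have nearest: "norm (x - p) \<le> norm (x - y)" if "y \<in> K" for y
    using p infdist_le[OF that, of x] by (simp add: projector_def dist_norm)
  show polar: "(x - p) \<bullet> y \<le> 0" if "y \<in> K" for y
    using assms that \<open>p \<in> K\<close>
    by (intro inner_nonpos_if_nearest_along nearest is_cone_convex_add is_cone_scaleR)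
  have "(x - p) \<bullet> (- p) \<le> 0"
  proof (intro inner_nonpos_if_nearest_along nearest)
    fix t :: real
    assume "0 < t" "t < 1"
    then have "(1 - t) *\<^sub>R p \<in> K"
      using assms(1) \<open>p \<in> K\<close> by (intro is_cone_scaleR) auto
    then show "p + t *\<^sub>R (- p) \<in> K"
      by (simp add: algebra_simps)
  qed
  then show "(x - p) \<bullet> p = 0"
    using polar[OF \<open>p \<in> K\<close>] by simp
qed

lemma polar_cone_iff:
  "u \<in> polar_cone K \<longleftrightarrow> (\<forall>y\<in>K. u \<bullet> y \<le> 0)"
  by (simp add: polar_cone_def SUP_le_iff)

section \<open>Projection onto the intersection of a cone and a sphere\<close>

lemma is_cone_radial_point_in_sphere:
  fixes K :: "'a::real_normed_vector set"
  assumes "is_cone K" "y \<in> K" "y \<noteq> 0" "\<rho> > 0"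
  shows "(\<rho> / norm y) *\<^sub>R y \<in> K \<inter> sphere 0 \<rho>"
  using assms by (auto intro!: is_cone_scaleR)

text \<open>
  The identity from which the distance and the uniqueness of the minimizer are both read off; the
  last term is the defect \<open>2 (norm p * \<rho> - p \<bullet> y)\<close> in the Cauchy-Schwarz inequality.
\<close>
lemma norm_diff_sphere_decomposition:
  fixes x p y :: "'a::real_inner"
  assumes "(x - p) \<bullet> p = 0" "p \<noteq> 0" "norm y = \<rho>" "\<rho> > 0"
  shows "(norm (x - y))\<^sup>2 = (norm (x - p))\<^sup>2 + (norm p - \<rho>)\<^sup>2 - 2 * ((x - p) \<bullet> y)
           + (norm p / \<rho>) * (norm ((\<rho> / norm p) *\<^sub>R p - y))\<^sup>2"
proof -
  define z where "z = (\<rho> / norm p) *\<^sub>R p"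
  have "norm z = \<rho>"
    using assms by (simp add: z_def)
  have "(norm (z - y))\<^sup>2 = (norm z)\<^sup>2 + (norm y)\<^sup>2 - 2 * (z \<bullet> y)"
    unfolding power2_norm_eq_inner by (simp add: inner_diff_left inner_diff_right inner_commute)
  also have "\<dots> = 2 * \<rho>\<^sup>2 - 2 * (\<rho> / norm p * (p \<bullet> y))"
    using \<open>norm z = \<rho>\<close> assms(3) by (simp add: z_def)
  finally have defect: "(norm p / \<rho>) * (norm (z - y))\<^sup>2 = 2 * (norm p * \<rho>) - 2 * (p \<bullet> y)"
    using assms by (simp add: field_simps power2_eq_square)
  have "(norm (x - y))\<^sup>2 = (norm (x - p))\<^sup>2 + 2 * ((x - p) \<bullet> (p - y)) + (norm (p - y))\<^sup>2"
    unfolding power2_norm_eq_inner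
    by (simp add: inner_diff_left inner_diff_right inner_commute)
  also have "(x - p) \<bullet> (p - y) = - ((x - p) \<bullet> y)"
    using assms(1) by (simp add: inner_diff_right)
  also have "(norm (p - y))\<^sup>2 = (norm p)\<^sup>2 + \<rho>\<^sup>2 - 2 * (p \<bullet> y)"
    using assms(3) unfolding power2_norm_eq_inner assms(3)[symmetric]
    by (simp add: inner_diff_left inner_diff_right inner_commute)
  finally show ?thesis
    using defect by (simp add: z_def power2_diff algebra_simps)
qed

theorem theorem8p1:
  fixes K C :: "'a::{real_inner, complete_space} set" and \<rho> :: real
  assumes "K \<noteq> {}" and "closed K" and "convex K" and "is_cone K"
    and "\<rho> > 0"
    and "C = K \<inter> sphere 0 \<rho>"
    and "K \<noteq> {0}"
  shows "(\<forall>x \<in> orthogonal_comp K.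
            projector C x = C \<and> infdist x C = sqrt ((norm x)\<^sup>2 + \<rho>\<^sup>2)) \<and>
         (\<forall>x \<in> UNIV - polar_cone K.
            projector C x = {(\<rho> / norm (proj_point K x)) *\<^sub>R proj_point K x} \<and>
            infdist x C = sqrt ((infdist x K)\<^sup>2 + (norm (proj_point K x) - \<rho>)\<^sup>2))"
proof (intro conjI ballI)
  fix x
  assume x: "x \<in> orthogonal_comp K"
  have eq: "norm (x - y) = sqrt ((norm x)\<^sup>2 + \<rho>\<^sup>2)" if "y \<in> C" for y
  proof (rule real_sqrt_unique[symmetric])
    have "x \<bullet> y = 0"
      using x that assms(6) by (simp add: orthogonal_comp_def orthogonal_def inner_commute[of x])
    then show "(norm (x - y))\<^sup>2 = (norm x)\<^sup>2 + \<rho>\<^sup>2"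
      using that assms(6) norm_add_Pythagorean[of x "- y"] by (simp add: orthogonal_def)
  qed simp
  obtain c where "c \<in> C"
    using assms is_cone_radial_point_in_sphere[of K _ \<rho>] by blast
  then show dist: "infdist x C = sqrt ((norm x)\<^sup>2 + \<rho>\<^sup>2)"
    using infdist_eq_if_nearest[of c C x] eq by simp
  show "projector C x = C"
    using eq dist by (auto simp: projector_def)
next
  fix x
  assume x: "x \<in> UNIV - polar_cone K"
  obtain p where p: "projector K x = {p}"
    using Hilbert_projection assms by blast
  then have proj: "proj_point K x = p"
    by (simp add: proj_point_def)
  have "p \<in> K" and dK: "infdist x K = norm (x - p)"
    using p by (auto simp: projector_def)
  note cone_proj = convex_cone_projection[of K p x, OF assms(4,3), unfolded p, OF singletonI]
  have "p \<noteq> 0"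
    using x cone_proj(2) by (auto simp: polar_cone_iff)
  define z where "z = (\<rho> / norm p) *\<^sub>R p"
  have "z \<in> C"
    using is_cone_radial_point_in_sphere[OF assms(4) \<open>p \<in> K\<close> \<open>p \<noteq> 0\<close> assms(5)] assms(6) by (simp add: z_def)
  define D where "D = (norm (x - p))\<^sup>2 + (norm p - \<rho>)\<^sup>2"
  note decomposition = norm_diff_sphere_decomposition[of x p _ \<rho>,
      OF cone_proj(1) \<open>p \<noteq> 0\<close> _ assms(5), folded z_def D_def]
  have lower: "D + (norm p / \<rho>) * (norm (z - y))\<^sup>2 \<le> (norm (x - y))\<^sup>2" if "y \<in> C" for y
    using decomposition[of y] cone_proj(2)[of y] that assms(6) by simp
  have "(x - p) \<bullet> z = 0"
    using cone_proj(1) by (simp add: z_def)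
  then have Dz: "(norm (x - z))\<^sup>2 = D"
    using decomposition[of z] \<open>z \<in> C\<close> assms(6) by simp
  have nearest: "norm (x - z) \<le> norm (x - y)" if "y \<in> C" for y
  proof (rule power2_le_imp_le)
    have "0 \<le> (norm p / \<rho>) * (norm (z - y))\<^sup>2"
      using assms(5) by simp
    then show "(norm (x - z))\<^sup>2 \<le> (norm (x - y))\<^sup>2"
      using lower[OF that] Dz by linarith
  qed simp
  have dC: "infdist x C = norm (x - z)"
    using infdist_eq_if_nearest[OF \<open>z \<in> C\<close> nearest] .
  have unique: "y = z" if "y \<in> C" "norm (x - y) = norm (x - z)" for y
  proof -
    have "(norm p / \<rho>) * (norm (z - y))\<^sup>2 \<le> 0"
      using lower[OF that(1)] Dz that(2) by simp
    moreover have "norm p / \<rho> > 0"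
      using \<open>p \<noteq> 0\<close> assms(5) by simp
    ultimately have "(norm (z - y))\<^sup>2 \<le> 0"
      by (simp only: mult_le_0_iff) linarith
    then show ?thesis by simp
  qed
  show "projector C x = {(\<rho> / norm (proj_point K x)) *\<^sub>R proj_point K x}"
    unfolding proj z_def[symmetric] projector_def dC using \<open>z \<in> C\<close> unique by blast
  show "infdist x C = sqrt ((infdist x K)\<^sup>2 + (norm (proj_point K x) - \<rho>)\<^sup>2)"
    unfolding proj dK D_def[symmetric] dC Dz[symmetric] by simp
qed

end
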